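(* Let $p\ge1$, let $m_1,\ldots,m_p\ge0$ be integers, let $\mathbf k=(k_1,\ldots,k_r)$ be a non-empty index of positive integers, and let $x\in(0,1)$. Then $$\begin{aligned}&\int_{x<t_p<\cdots<t_1<1}\frac{\log^{m_p}\!\left(\frac{1-x}{1-t_p}\right)}{t_p}\prod_{l=1}^{p-1}\frac{\log^{m_l}\!\left(\frac{1-t_{l+1}}{1-t_l}\right)}{t_l}\;\mathrm{Li}_{\mathbf k}(t_1)\,dt_1\cdots dt_p\\ &=m_1!\cdots m_p!\sum_{\mathbf k',\,j\ge0}c_{\mathbf k}(\mathbf k';j)\sum_{\substack{j_0+\cdots+j_p=j\\ j_0,\ldots,j_p\ge0}}\frac{(-1)^{j_0}}{j_0!}\Bigl\{\prod_{l=1}^p\binom{m_l+j_l}{j_l}\Bigr\}\log^{j_0}(1-x)\,\mathrm{Li}_{m_p+j_p+1,\ldots,m_1+j_1+1,\,\mathbf k'}(1-x),\end{aligned}$$ where the outer sum runs over indices $\mathbf k'$ (possibly empty) and integers $j\ge0$ with $|\mathbf k'|+j\le|\mathbf k|$.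
   Context: An index is a finite sequence of positive integers; $|\mathbf k|$ is the sum of its entries. $\mathrm{Li}_{k_1,\ldots,k_r}(x)=\sum_{n_1>\cdots>n_r\ge1}x^{n_1}/(n_1^{k_1}\cdots n_r^{k_r})$ and $\mathrm{Li}_\emptyset=1$. Zeroth powers of logarithms are $1$. $\{1\}_j$ is $1$ repeated $j$ times. The coefficients $c_{\mathbf k}(\mathbf k';j)$ are those in the known theorem of Kaneko and Tsumura: for every index $\mathbf k$, $$\mathrm{Li}_{\mathbf k}(1-y)=\sum_{\mathbf k',\,j\ge0}c_{\mathbf k}(\mathbf k';j)\,\mathrm{Li}_{\{1\}_j}(1-y)\,\mathrm{Li}_{\mathbf k'}(y)\qquad(0<y<1),$$ the sum running over (possibly empty) indices $\mathbf k'$ and $j\ge0$ with $|\mathbf k'|+j\le|\mathbf k|$, where $c_{\mathbf k}(\mathbf k';j)$ is a $\mathbb Q$-linear combination of multiple zeta values of weight $|\mathbf k|-|\mathbf k'|-j$ (the constant $1$ being regarded as a multiple zeta value of weight $0$). *)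

theory Defs
  imports "HOL-Analysis.Analysis"
begin

definition is_index :: "nat list \<Rightarrow> bool" where
  "is_index k \<longleftrightarrow> (\<forall>i\<in>set k. 1 \<le> i)"

abbreviation weight :: "nat list \<Rightarrow> nat" where
  "weight k \<equiv> sum_list k"

definition decreasing_tuples :: "nat \<Rightarrow> nat list set" where
  "decreasing_tuples r = {n. length n = r \<and> sorted_wrt (>) n \<and> (\<forall>i\<in>set n. 1 \<le> i)}"

text \<open>The exponent of \<open>x\<close> is the largest summation variable, which is paired with the
  first entry of the index. The series is only used where it converges absolutely: for
  \<open>0 < x < 1\<close>, and at \<open>x = 1\<close> for indices with first entry at least 2.\<close>

definition Li :: "nat list \<Rightarrow> real \<Rightarrow> real" where
  "Li k x = (if k = [] then 1
     else (\<Sum>\<^sub>\<infinity>n\<in>decreasing_tuples (length k). x ^ hd n / (\<Prod>i<length k. real (n ! i) ^ (k ! i))))"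

text \<open>The empty index is admissible of weight 0 and has multiple zeta value 1.\<close>

definition admissible_indices :: "nat \<Rightarrow> nat list set" where
  "admissible_indices w = {k. is_index k \<and> weight k = w \<and> (k \<noteq> [] \<longrightarrow> 2 \<le> hd k)}"

definition mzv :: "nat list \<Rightarrow> real" where
  "mzv k = Li k 1"

definition mzv_span :: "nat \<Rightarrow> real set" where
  "mzv_span w = {\<Sum>k\<in>admissible_indices w. of_rat (q k) * mzv k | q :: nat list \<Rightarrow> rat. True}"

definition bounded_pairs :: "nat \<Rightarrow> (nat list \<times> nat) set" where
  "bounded_pairs w = {(k', j). is_index k' \<and> weight k' + j \<le> w}"

text \<open>The property by which the theorem of Kaneko and Tsumura specifies the coefficients
  \<open>c\<^sub>k(k'; j)\<close>, written \<open>c k k' j\<close>.\<close>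

definition kaneko_tsumura_coeffs :: "(nat list \<Rightarrow> nat list \<Rightarrow> nat \<Rightarrow> real) \<Rightarrow> bool" where
  "kaneko_tsumura_coeffs c \<longleftrightarrow>
     (\<forall>k. is_index k \<longrightarrow>
        (\<forall>(k', j)\<in>bounded_pairs (weight k). c k k' j \<in> mzv_span (weight k - weight k' - j)) \<and>
        (\<forall>y. 0 < y \<and> y < 1 \<longrightarrow>
           Li k (1 - y) =
             (\<Sum>(k', j)\<in>bounded_pairs (weight k). c k k' j * Li (replicate j 1) (1 - y) * Li k' y)))"

definition compositions :: "nat \<Rightarrow> nat \<Rightarrow> (nat \<Rightarrow> nat) set" where
  "compositions p j = {J \<in> {0..p} \<rightarrow>\<^sub>E UNIV. (\<Sum>l=0..p. J l) = j}"

definition ordered_region :: "nat \<Rightarrow> real \<Rightarrow> (nat \<Rightarrow> real) set" where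
  "ordered_region p x = {t. x < t p \<and> (\<forall>l\<in>{1..<p}. t (Suc l) < t l) \<and> t 1 < 1}"

definition integrand ::
    "nat \<Rightarrow> (nat \<Rightarrow> nat) \<Rightarrow> nat list \<Rightarrow> real \<Rightarrow> (nat \<Rightarrow> real) \<Rightarrow> real" where
  "integrand p m k x t =
     ln ((1 - x) / (1 - t p)) ^ m p / t p *
     (\<Prod>l\<in>{1..<p}. ln ((1 - t (l + 1)) / (1 - t l)) ^ m l / t l) *
     Li k (t 1)"

text \<open>Sums over infinite sets default to 0, so the index sets of the finite sums above are
  shown to be finite.\<close>

lemma length_le_weight: "is_index k \<Longrightarrow> length k \<le> weight k"
  by (induction k) (auto simp: is_index_def)

lemma finite_indices: "finite {k. is_index k \<and> weight k \<le> w}"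
proof (rule finite_subset)
  show "{k. is_index k \<and> weight k \<le> w} \<subseteq> {k. set k \<subseteq> {..w} \<and> length k \<le> w}"
    using length_le_weight member_le_sum_list by (fastforce intro: order_trans)
  show "finite {k. set k \<subseteq> {..w} \<and> length k \<le> w}"
    by (rule finite_lists_length_le) simp
qed

lemma finite_admissible_indices: "finite (admissible_indices w)"
  by (rule finite_subset[OF _ finite_indices[of w]]) (auto simp: admissible_indices_def)

lemma finite_bounded_pairs: "finite (bounded_pairs w)"
  by (rule finite_subset[of _ "{k. is_index k \<and> weight k \<le> w} \<times> {..w}"])
     (auto simp: bounded_pairs_def finite_indices)

lemma finite_compositions: "finite (compositions p j)"
proof (rule finite_subset)
  show "compositions p j \<subseteq> {0..p} \<rightarrow>\<^sub>E {..j}"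
  proof
    fix J assume "J \<in> compositions p j"
    then have J: "J \<in> {0..p} \<rightarrow>\<^sub>E UNIV" "(\<Sum>l=0..p. J l) = j"
      by (auto simp: compositions_def)
    have "J l \<le> j" if "l \<in> {0..p}" for l
      using member_le_sum[OF that, of J] J(2) by simp
    then show "J \<in> {0..p} \<rightarrow>\<^sub>E {..j}"
      using J(1) by (auto simp: PiE_def)
  qed
  show "finite ({0..p} \<rightarrow>\<^sub>E {..j})"
    by (intro finite_PiE) auto
qed

end

theory Submission
  imports Defs "HOL-Real_Asymp.Real_Asymp"
begin

text \<open>
  Grouping the defining series of \<open>Li k\<close> by the largest summation variable gives a power series
  with non-negative coefficients. Multiplication by \<open>1 / (1 - u)\<close> replaces its coefficients by
  their partial sums, and integration against \<open>ln (z / u) ^ n\<close> turns \<open>u ^ d\<close> into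
  \<open>n! z ^ (d + 1) / (d + 1) ^ (n + 1)\<close>. Hence integrating
  \<open>ln (z / u) ^ n / (1 - u) * Li k u\<close> over \<open>(0, z)\<close> prepends the entry \<open>n + 1\<close> to the index, up
  to the factor \<open>n!\<close>. With \<open>u = 1 - t\<close>, iterating this from \<open>t\<^sub>1\<close> to \<open>t\<^sub>p\<close> evaluates the integral
  with \<open>Li k' (1 - t\<^sub>1)\<close> in place of \<open>Li k (t\<^sub>1)\<close>. The property of Kaneko and Tsumura expresses
  \<open>Li k (t\<^sub>1)\<close> through \<open>(- ln (1 - t\<^sub>1)) ^ j / j!\<close> and \<open>Li k' (1 - t\<^sub>1)\<close>; the logarithm
  \<open>- ln (1 - t\<^sub>1)\<close> telescopes into \<open>- ln (1 - x)\<close> plus the logarithms occurring in the integrand,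
  and the multinomial theorem reduces the claim to the case already treated.
\<close>

section \<open>Power series of multiple polylogarithms\<close>

text \<open>The coefficient of \<open>x ^ n\<close> in the series of \<open>Li\<close> grouped by
  its largest summation variable. For a non-empty index and \<open>n = 0\<close> the numerator is an
  empty sum, so the value is 0 even if the denominator is 0.\<close>

fun polylog_coeff :: "nat list \<Rightarrow> nat \<Rightarrow> real" where
  "polylog_coeff [] n = (if n = 0 then 1 else 0)"
| "polylog_coeff (s # k) n = (\<Sum>m<n. polylog_coeff k m) / real n ^ s"

lemma polylog_coeff_nonneg: "0 \<le> polylog_coeff k n"
  by (induction k arbitrary: n) (auto intro!: divide_nonneg_nonneg sum_nonneg)

definition polylog :: "nat list \<Rightarrow> real \<Rightarrow> real" where
  "polylog k x = (\<Sum>n. polylog_coeff k n * x ^ n)"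

text \<open>Cauchy product with the geometric series; non-negativity of \<open>a\<close> turns the
  assumed summability into the absolute summability that the product needs.\<close>

lemma partial_sums_geometric:
  fixes a :: "nat \<Rightarrow> real"
  assumes a: "\<And>n. 0 \<le> a n" and s: "summable (\<lambda>n. a n * x ^ n)" and x: "0 \<le> x" "x < 1"
  shows "(\<lambda>d. (\<Sum>m\<le>d. a m) * x ^ d) sums ((\<Sum>n. a n * x ^ n) / (1 - x))"
proof -
  have "(\<lambda>d. \<Sum>i\<le>d. (a i * x ^ i) * x ^ (d - i)) sums ((\<Sum>n. a n * x ^ n) * (\<Sum>n. x ^ n))"
    using s x a by (intro Cauchy_product_sums) (auto simp: abs_mult)
  moreover have "(\<Sum>i\<le>d. (a i * x ^ i) * x ^ (d - i)) = (\<Sum>m\<le>d. a m) * x ^ d" for d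
    unfolding sum_distrib_right
    by (intro sum.cong refl) (simp add: mult.assoc power_add[symmetric])
  ultimately show ?thesis
    using x by (simp add: suminf_geometric field_simps)
qed

lemma summable_polylog:
  assumes x: "0 \<le> x" "x < 1"
  shows "summable (\<lambda>n. polylog_coeff k n * x ^ n)"
proof (induction k)
  case Nil
  have "(\<lambda>n. polylog_coeff [] n * x ^ n) = (\<lambda>n. if n = 0 then 1 else 0)"
    by auto
  then show ?case by simp
next
  case (Cons s k)
  \<comment> \<open>Shifting the index by one makes the denominator at least 1, so dropping it gives
    a majorant: the partial-sum series of \<open>k\<close>, which converges by the induction
    hypothesis.\<close>
  have "summable (\<lambda>d. polylog_coeff (s # k) (Suc d) * x ^ Suc d)"
  proof (rule summable_comparison_test')
    show "summable (\<lambda>d. (\<Sum>m\<le>d. polylog_coeff k m) * x ^ d)"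
      using partial_sums_geometric[OF polylog_coeff_nonneg Cons x] by (rule sums_summable)
    fix d :: nat
    have "polylog_coeff (s # k) (Suc d) \<le> (\<Sum>m\<le>d. polylog_coeff k m)"
      using divide_left_mono[of 1 "real (Suc d) ^ s" "\<Sum>m\<le>d. polylog_coeff k m"]
      by (simp add: lessThan_Suc_atMost sum_nonneg polylog_coeff_nonneg one_le_power del: of_nat_Suc)
    moreover have "x ^ Suc d \<le> x ^ d"
      using x by (intro power_decreasing) auto
    ultimately show "norm (polylog_coeff (s # k) (Suc d) * x ^ Suc d)
        \<le> (\<Sum>m\<le>d. polylog_coeff k m) * x ^ d"
      using x polylog_coeff_nonneg[of "s # k" "Suc d"]
      by (auto simp: abs_mult simp del: polylog_coeff.simps power_Suc intro!: mult_mono sum_nonneg polylog_coeff_nonneg)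
  qed
  then show ?case by (subst (asm) summable_Suc_iff)
qed

lemma polylog_nonneg: "0 \<le> x \<Longrightarrow> x < 1 \<Longrightarrow> 0 \<le> polylog k x"
  unfolding polylog_def by (intro suminf_nonneg summable_polylog) (auto simp: polylog_coeff_nonneg)

lemma polylog_measurable [measurable]: "polylog k \<in> borel_measurable borel"
  unfolding polylog_def by measurable

section \<open>Grouping the defining series by the largest variable\<close>

text \<open>The value 0 on the empty tuple lies below every admissible entry and gives the exponent
  0 of \<open>Li []\<close>, so the empty tuple fits the general recursion.\<close>

definition top_index :: "nat list \<Rightarrow> nat" where
  "top_index ns = (if ns = [] then 0 else hd ns)"

definition tuples_with_top :: "nat \<Rightarrow> nat \<Rightarrow> nat list set" where
  "tuples_with_top r n = {ns \<in> decreasing_tuples r. top_index ns = n}"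

lemma tuples_with_top_0: "tuples_with_top 0 n = (if n = 0 then {[]} else {})"
  by (auto simp: tuples_with_top_def decreasing_tuples_def top_index_def)

lemma tuples_with_top_Suc: "tuples_with_top (Suc r) n = (#) n ` (\<Union>m<n. tuples_with_top r m)"
proof (intro equalityI subsetI)
  fix ns assume "ns \<in> tuples_with_top (Suc r) n"
  then show "ns \<in> (#) n ` (\<Union>m<n. tuples_with_top r m)"
    by (cases ns) (auto simp: tuples_with_top_def decreasing_tuples_def top_index_def)
next
  fix ns assume "ns \<in> (#) n ` (\<Union>m<n. tuples_with_top r m)"
  then obtain ms where ms: "ns = n # ms" "ms \<in> decreasing_tuples r" "top_index ms < n"
    by (auto simp: tuples_with_top_def)
  show "ns \<in> tuples_with_top (Suc r) n"
    using ms by (cases ms) (auto simp: tuples_with_top_def decreasing_tuples_def top_index_def)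
qed

lemma finite_tuples_with_top: "finite (tuples_with_top r n)"
  by (induction r arbitrary: n) (auto simp: tuples_with_top_0 tuples_with_top_Suc)

text \<open>Removing the leading entry \<open>n\<close> splits off the factor
  \<open>1 / n ^ s\<close> and leaves tuples with top \<open>m < n\<close>; these classes are
  disjoint, which reproduces the recursion of \<open>polylog_coeff\<close>.\<close>

lemma sum_tuples_with_top:
  "(\<Sum>ns\<in>tuples_with_top (length k) n. 1 / (\<Prod>i<length k. real (ns ! i) ^ (k ! i))) = polylog_coeff k n"
proof (induction k arbitrary: n)
  case Nil
  show ?case by (simp add: tuples_with_top_0)
next
  case (Cons s k)
  have "(\<Sum>ns\<in>tuples_with_top (length (s # k)) n. 1 / (\<Prod>i<length (s # k). real (ns ! i) ^ ((s # k) ! i)))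
     = (\<Sum>ns\<in>(\<Union>m<n. tuples_with_top (length k) m).
         (1 / (\<Prod>i<length k. real (ns ! i) ^ (k ! i))) / real n ^ s)"
    by (simp add: tuples_with_top_Suc sum.reindex prod.lessThan_Suc_shift del: prod.lessThan_Suc) (simp add: mult.commute)
  also have "\<dots> = (\<Sum>m<n. \<Sum>ns\<in>tuples_with_top (length k) m.
         (1 / (\<Prod>i<length k. real (ns ! i) ^ (k ! i))) / real n ^ s)"
    by (rule sum.UNION_disjoint) (auto simp: finite_tuples_with_top, auto simp: tuples_with_top_def)
  also have "\<dots> = (\<Sum>m<n. polylog_coeff k m / real n ^ s)"
    by (simp only: sum_divide_distrib[symmetric] Cons)
  finally show ?case by (simp add: sum_divide_distrib)
qed

lemma Li_eq_polylog:
  assumes x: "0 \<le> x" "x < 1"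
  shows "Li k x = polylog k x"
proof -
  define r where "r = length k"
  define f where "f = (\<lambda>ns. x ^ top_index ns / (\<Prod>i<r. real (ns ! i) ^ (k ! i)))"
  have f: "0 \<le> f ns" for ns
    using x unfolding f_def by (intro divide_nonneg_nonneg prod_nonneg) auto
  have inner: "((\<lambda>ns. f ns) has_sum polylog_coeff k n * x ^ n) (tuples_with_top r n)" for n
  proof -
    have "(\<Sum>ns\<in>tuples_with_top r n. f ns) =
        (\<Sum>ns\<in>tuples_with_top r n. 1 / (\<Prod>i<r. real (ns ! i) ^ (k ! i)) * x ^ n)"
      by (intro sum.cong) (auto simp: f_def tuples_with_top_def)
    also have "\<dots> = polylog_coeff k n * x ^ n"
      by (simp only: sum_distrib_right[symmetric] sum_tuples_with_top r_def)
    finally show ?thesis using has_sum_finite[OF finite_tuples_with_top[of r n], of f] by simp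
  qed
  have outer: "((\<lambda>n. polylog_coeff k n * x ^ n) has_sum polylog k x) UNIV"
    unfolding polylog_def using x
    by (intro norm_summable_imp_has_sum summable_sums summable_polylog)
       (auto simp: abs_mult polylog_coeff_nonneg summable_polylog)
  \<comment> \<open>Since all terms are non-negative, convergence of the iterated sum already gives
    summability over all pairs.\<close>
  have "((\<lambda>(n, ns). f ns) has_sum polylog k x) (Sigma UNIV (tuples_with_top r))"
    using inner outer f
    by (intro has_sum_SigmaI[where g = "\<lambda>n. polylog_coeff k n * x ^ n"] summable_on_SigmaI[where g = "\<lambda>n. polylog_coeff k n * x ^ n"])
       (auto intro: has_sum_imp_summable)
  also have "?this \<longleftrightarrow> (f has_sum polylog k x) (decreasing_tuples r)"
    by (rule has_sum_reindex_bij_witness[where i = "\<lambda>ns. (top_index ns, ns)" and j = snd])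
       (auto simp: tuples_with_top_def)
  finally have "infsum f (decreasing_tuples r) = polylog k x"
    by (rule infsumI)
  \<comment> \<open>\<open>top_index\<close> agrees with \<open>hd\<close> on non-empty tuples; for
    \<open>k = []\<close> the only term is that of the empty tuple, namely 1.\<close>
  moreover have "Li k x = infsum f (decreasing_tuples r)"
  proof (cases "k = []")
    case True
    have "decreasing_tuples 0 = {[]}" by (auto simp: decreasing_tuples_def)
    then show ?thesis using True by (simp add: Li_def r_def f_def top_index_def)
  next
    case False
    then show ?thesis unfolding Li_def f_def r_def
      by (auto intro!: infsum_cong simp: top_index_def decreasing_tuples_def)
  qed
  ultimately show ?thesis by simp
qed

section \<open>Prepending an entry by integration against a power of the logarithm\<close>

text \<open>The primitive obtained by integrating by parts \<open>n\<close> times, lowering the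
  power of the logarithm each time.\<close>

lemma log_power_primitive:
  fixes z u c :: real
  assumes "0 < z" "0 < u" "0 < c"
  shows "((\<lambda>u. \<Sum>i\<le>n. fact n / fact i * ln (z / u) ^ i * u powr c / c ^ (Suc n - i))
           has_real_derivative ln (z / u) ^ n * u powr (c - 1)) (at u)"
proof (induction n)
  case 0
  show ?case using assms
    by (auto intro!: derivative_eq_intros)
next
  case (Suc n)
  define F where "F = (\<lambda>u. \<Sum>i\<le>n. fact n / fact i * ln (z / u) ^ i * u powr c / c ^ (Suc n - i))"
  have F: "(F has_real_derivative ln (z / u) ^ n * u powr (c - 1)) (at u)"
    using Suc unfolding F_def .
  have "(\<Sum>i\<le>Suc n. fact (Suc n) / fact i * ln (z / u) ^ i * u powr c / c ^ (Suc (Suc n) - i))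
      = real (Suc n) / c * F u + ln (z / u) ^ Suc n * u powr c / c" for u
  proof -
    have "(\<Sum>i\<le>n. fact (Suc n) / fact i * ln (z / u) ^ i * u powr c / c ^ (Suc (Suc n) - i))
        = real (Suc n) / c * F u"
      unfolding F_def sum_distrib_left using assms
      by (intro sum.cong refl) (simp add: Suc_diff_le field_simps del: of_nat_Suc)
    then show ?thesis by simp
  qed
  \<comment> \<open>Differentiating the logarithm in the last summand produces
    \<open>- (n + 1) / c\<close> times the previous integrand, which the derivative of the first
    summand cancels.\<close>
  moreover have "((\<lambda>u. real (Suc n) / c * F u + ln (z / u) ^ Suc n * u powr c / c)
      has_real_derivative ln (z / u) ^ Suc n * u powr (c - 1)) (at u)"
    using assms
    by (auto intro!: derivative_eq_intros F simp del: of_nat_Suc power_Suc)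
       (simp add: field_simps powr_diff)
  ultimately show ?case by presburger
qed

lemma nn_integral_log_power:
  fixes z :: real
  assumes z: "0 < z"
  shows "(\<integral>\<^sup>+u. ennreal (indicator {0<..<z} u * (ln (z / u) ^ n * u ^ d)) \<partial>lborel)
       = ennreal (fact n * z ^ Suc d / real (Suc d) ^ Suc n)"
proof -
  define c where "c = real (Suc d)"
  have c: "0 < c" by (simp add: c_def)
  define F where "F = (\<lambda>u. \<Sum>i\<le>n. fact n / fact i * ln (z / u) ^ i * u powr c / c ^ (Suc n - i))"
  \<comment> \<open>For \<open>i > 0\<close> the logarithm is unbounded at 0, but the positive power
    \<open>u powr c\<close> dominates it, so the lower endpoint contributes nothing.\<close>
  have lim0: "((\<lambda>u. ln (z / u) ^ i * u powr c) \<longlongrightarrow> 0) (at_right 0)" for i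
    using z c by real_asymp
  have F0: "(F \<longlongrightarrow> 0) (at_right 0)"
  proof -
    have "((\<lambda>u. \<Sum>i\<le>n. fact n / fact i / c ^ (Suc n - i) * (ln (z / u) ^ i * u powr c)) \<longlongrightarrow>
       (\<Sum>i\<le>n. fact n / fact i / c ^ (Suc n - i) * 0)) (at_right 0)"
      by (intro tendsto_intros lim0)
    then show ?thesis by (simp add: F_def mult.assoc)
  qed
  \<comment> \<open>At \<open>u = z\<close> the logarithm vanishes, so only the summand with
    exponent 0 survives.\<close>
  have "F z = (\<Sum>i\<le>n. if i = 0 then fact n * z powr c / c ^ Suc n else 0)"
    unfolding F_def using z by (intro sum.cong) auto
  then have Fz_eq: "F z = fact n * z ^ Suc d / c ^ Suc n"
    using z by (simp add: c_def powr_realpow[symmetric] del: of_nat_Suc power_Suc)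
  have "isCont F z"
    using log_power_primitive[OF z z c, of n] unfolding F_def by (rule DERIV_isCont)
  then have Fz: "(F \<longlongrightarrow> fact n * z ^ Suc d / c ^ Suc n) (at_left z)"
    unfolding isCont_def Fz_eq by (rule tendsto_within_subset) simp
  have deriv: "(F has_real_derivative ln (z / u) ^ n * u ^ d) (at u)" if "0 < u" for u
    using log_power_primitive[OF z that c, of n] that
    by (simp add: F_def c_def powr_realpow)
  have nonneg: "0 \<le> indicator {0<..<z} u * (ln (z / u) ^ n * u ^ d)" for u
    by (auto simp: indicator_def)
  have ein: "einterval 0 (ereal z) = {0<..<z}"
    by (auto simp: einterval_def zero_ereal_def)
  have asm: "AE u in lborel. 0 < ereal u \<longrightarrow> ereal u < ereal z \<longrightarrow> 0 \<le> ln (z / u) ^ n * u ^ d"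
    by (auto simp: zero_ereal_def)
  have cont: "isCont (\<lambda>u. ln (z / u) ^ n * u ^ d) u" if "0 < u" for u
    using z that by (auto intro!: continuous_intros)
  have R0: "((F \<circ> real_of_ereal) \<longlongrightarrow> 0) (at_right 0)"
    using F0 by (simp add: zero_ereal_def ereal_tendsto_simps)
  have Rz: "((F \<circ> real_of_ereal) \<longlongrightarrow> fact n * z ^ Suc d / c ^ Suc n) (at_left (ereal z))"
    using Fz by (simp add: ereal_tendsto_simps)
  \<comment> \<open>This form of the fundamental theorem takes the endpoint values as one-sided
    limits and yields integrability together with the value.\<close>
  note FTC = interval_integral_FTC_nonneg[where a = 0 and b = "ereal z", OF _ deriv cont asm R0 Rz]
  have int: "set_integrable lborel {0<..<z} (\<lambda>u. ln (z / u) ^ n * u ^ d)"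
    using FTC(1) z by (simp add: ein zero_ereal_def[symmetric])
  have val: "(LBINT u:{0<..<z}. ln (z / u) ^ n * u ^ d) = fact n * z ^ Suc d / c ^ Suc n"
    using FTC(2) z by (simp add: ein interval_lebesgue_integral_def)
  have "(\<integral>\<^sup>+u. ennreal (indicator {0<..<z} u * (ln (z / u) ^ n * u ^ d)) \<partial>lborel)
     = ennreal (LBINT u:{0<..<z}. ln (z / u) ^ n * u ^ d)"
    using int nonneg unfolding set_integrable_def set_lebesgue_integral_def
    by (subst nn_integral_eq_integral) auto
  then show ?thesis unfolding val c_def .
qed

text \<open>All terms of the expanded integrand are non-negative, so integration term by term needs
  no prior integrability.\<close>

lemma nn_integral_polylog_Cons:
  assumes z: "0 < z" "z < 1"
  shows "(\<integral>\<^sup>+u. ennreal (indicator {0<..<z} u * (ln (z / u) ^ n / (1 - u) * polylog k u)) \<partial>lborel)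
       = ennreal (fact n * polylog (Suc n # k) z)"
proof -
  define a where "a = (\<lambda>d. \<Sum>m\<le>d. polylog_coeff k m)"
  have a: "0 \<le> a d" for d
    by (auto simp: a_def intro!: sum_nonneg polylog_coeff_nonneg)
  have expand: "ennreal (indicator {0<..<z} u * (ln (z / u) ^ n / (1 - u) * polylog k u))
      = (\<Sum>d. ennreal (a d) * ennreal (indicator {0<..<z} u * (ln (z / u) ^ n * u ^ d)))" for u
  proof (cases "u \<in> {0<..<z}")
    case True
    then have u: "0 < u" "u < z" "u < 1" "0 \<le> ln (z / u)" using z by auto
    have "(\<lambda>d. ln (z / u) ^ n * (a d * u ^ d)) sums (ln (z / u) ^ n * (polylog k u / (1 - u)))"
      unfolding a_def polylog_def using u
      by (intro sums_mult partial_sums_geometric summable_polylog polylog_coeff_nonneg) auto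
    moreover have "0 \<le> ln (z / u) ^ n * (a d * u ^ d)" for d
      using u a by auto
    ultimately have "(\<lambda>d. ennreal (ln (z / u) ^ n * (a d * u ^ d)))
        sums ennreal (ln (z / u) ^ n * (polylog k u / (1 - u)))"
      by (subst sums_ennreal) (use u polylog_nonneg[of u k] in auto)
    from sums_unique[OF this] show ?thesis
      using True a by (simp add: ennreal_mult'[symmetric] mult_ac)
  qed simp
  have "(\<integral>\<^sup>+u. ennreal (indicator {0<..<z} u * (ln (z / u) ^ n / (1 - u) * polylog k u)) \<partial>lborel)
      = (\<Sum>d. ennreal (a d) * ennreal (fact n * z ^ Suc d / real (Suc d) ^ Suc n))"
    unfolding expand
    by (subst nn_integral_suminf) (auto simp: nn_integral_cmult nn_integral_log_power z simp del: of_nat_Suc power_Suc)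
  \<comment> \<open>The partial sum \<open>a d\<close> divided by \<open>(d + 1) ^ (n + 1)\<close>
    is by definition the coefficient of degree \<open>d + 1\<close> for the index
    \<open>Suc n # k\<close>.\<close>
  also have "\<dots> = (\<Sum>d. ennreal (fact n * (polylog_coeff (Suc n # k) (Suc d) * z ^ Suc d)))"
    by (intro suminf_cong, subst ennreal_mult'[symmetric])
       (auto simp: a_def sum_nonneg polylog_coeff_nonneg lessThan_Suc_atMost field_simps simp del: of_nat_Suc power_Suc)
  also have "\<dots> = ennreal (fact n * polylog (Suc n # k) z)"
  proof (rule sums_unique[symmetric])
    \<comment> \<open>The coefficient of degree 0 vanishes, so the shifted series has the same
      sum.\<close>
    have "(\<lambda>d. polylog_coeff (Suc n # k) (Suc d) * z ^ Suc d) sums polylog (Suc n # k) z"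
      using summable_sums[OF summable_polylog[of z "Suc n # k"]] z
      by (subst sums_Suc_iff) (auto simp: polylog_def simp del: power_Suc)
    then show "(\<lambda>d. ennreal (fact n * (polylog_coeff (Suc n # k) (Suc d) * z ^ Suc d)))
        sums ennreal (fact n * polylog (Suc n # k) z)"
      using z by (subst sums_ennreal)
        (auto intro!: sums_mult mult_nonneg_nonneg polylog_coeff_nonneg polylog_nonneg simp del: polylog_coeff.simps)
  qed
  finally show ?thesis .
qed

text \<open>The preceding integral with exponent 0 prepends an entry 1, and the powers of
  \<open>- ln (1 - u)\<close> divided by factorials satisfy the same recursion with the same value 0
  at the origin.\<close>

lemma polylog_replicate_1:
  assumes "0 < z" "z < 1"
  shows "polylog (replicate j 1) z = (- ln (1 - z)) ^ j / fact j"
  using assms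
proof (induction j arbitrary: z)
  case 0
  have "(\<lambda>n. polylog_coeff [] n * z ^ n) = (\<lambda>n. if n = 0 then 1 else 0)"
    by auto
  then show ?case using sums_single[of 0 "\<lambda>_. 1::real"] by (simp add: polylog_def sums_iff)
next
  case (Suc j)
  define F where "F = (\<lambda>u::real. (- ln (1 - u)) ^ Suc j / fact (Suc j))"
  define f where "f = (\<lambda>u::real. (- ln (1 - u)) ^ j / fact j / (1 - u))"
  have deriv: "(F has_real_derivative f u) (at u)" if "u < 1" for u
    unfolding F_def f_def using that
    by (auto intro!: derivative_eq_intros simp del: power_Suc of_nat_Suc)
  have "(\<integral>\<^sup>+u. ennreal (f u) * indicator {0..z} u \<partial>lborel) = ennreal (F z - F 0)"
    using Suc.prems
    by (intro nn_integral_FTC_Icc deriv has_field_derivative_at_within) (auto simp: f_def intro!: divide_nonneg_nonneg)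
  also have "(\<integral>\<^sup>+u. ennreal (f u) * indicator {0..z} u \<partial>lborel) =
      (\<integral>\<^sup>+u. ennreal (indicator {0<..<z} u * (ln (z / u) ^ 0 / (1 - u) * polylog (replicate j 1) u)) \<partial>lborel)"
  proof (rule nn_integral_cong_AE)
    \<comment> \<open>The induction hypothesis covers only the open interval; the two endpoints form
      a null set.\<close>
    have "AE u in lborel. u \<noteq> (0::real)" "AE u in lborel. u \<noteq> z"
      by (rule AE_lborel_singleton)+
    then show "AE u in lborel. ennreal (f u) * indicator {0..z} u =
        ennreal (indicator {0<..<z} u * (ln (z / u) ^ 0 / (1 - u) * polylog (replicate j 1) u))"
    proof eventually_elim
      case (elim u)
      then show ?case using Suc.IH[of u] Suc.prems
        by (auto simp: indicator_def f_def)
    qed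
  qed
  also have "\<dots> = ennreal (polylog (replicate (Suc j) 1) z)"
    using nn_integral_polylog_Cons[of z 0 "replicate j 1"] Suc.prems by simp
  finally have "ennreal (polylog (replicate (Suc j) 1) z) = ennreal (F z)"
    by (simp add: F_def)
  then show ?case
    using Suc.prems polylog_nonneg[of z "replicate (Suc j) 1"]
    by (simp add: F_def ennreal_inj del: power_Suc replicate_Suc)
qed

text \<open>Substitution \<open>u = 1 - t\<close>, giving the shape of a single integration in the
  iterated integral.\<close>

lemma nn_integral_polylog_Cons_reflected:
  assumes x: "0 < x" "x < 1"
  shows "(\<integral>\<^sup>+t. ennreal (indicator {x<..<1} t * (ln ((1 - x) / (1 - t)) ^ n / t * polylog k (1 - t))) \<partial>lborel)
       = ennreal (fact n * polylog (Suc n # k) (1 - x))"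
proof -
  have "(\<integral>\<^sup>+t. ennreal (indicator {x<..<1} t * (ln ((1 - x) / (1 - t)) ^ n / t * polylog k (1 - t))) \<partial>lborel)
    = (\<integral>\<^sup>+u. ennreal (indicator {0<..<1-x} u * (ln ((1 - x) / u) ^ n / (1 - u) * polylog k u)) \<partial>lborel)"
    by (subst nn_integral_real_affine[where c = "-1" and t = 1]) (auto intro!: nn_integral_cong simp: indicator_def)
  then show ?thesis using nn_integral_polylog_Cons[of "1 - x"] x by simp
qed

section \<open>Multinomial theorem over compositions\<close>

text \<open>Induction on \<open>p\<close>: splitting off the last entry reduces the claim to the
  binomial theorem.\<close>

lemma multinomial_compositions:
  fixes a :: "nat \<Rightarrow> real"
  shows "(\<Sum>l=0..p. a l) ^ j / fact j = (\<Sum>J\<in>compositions p j. \<Prod>l=0..p. a l ^ J l / fact (J l))"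
proof (induction p arbitrary: j)
  case 0
  have "compositions 0 j = {\<lambda>l\<in>{0}. j}"
    by (auto simp: compositions_def fun_eq_iff PiE_def extensional_def restrict_def)
  then show ?case by simp
next
  case (Suc p)
  have "(\<Sum>J\<in>compositions (Suc p) j. \<Prod>l=0..Suc p. a l ^ J l / fact (J l)) =
     (\<Sum>(i, J)\<in>Sigma {..j} (\<lambda>i. compositions p (j - i)).
        a (Suc p) ^ i / fact i * (\<Prod>l=0..p. a l ^ J l / fact (J l)))"
  \<comment> \<open>Members of \<open>compositions\<close> are extensional, so resetting position
    \<open>Suc p\<close> to \<open>undefined\<close> removes the last entry \<open>i\<close> and
    leaves a composition of \<open>j - i\<close>.\<close>
  proof (rule sum.reindex_bij_witness[where j = "\<lambda>J. (J (Suc p), J(Suc p := undefined))"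
        and i = "\<lambda>(i, J). J(Suc p := i)"], goal_cases)
    case (1 J) then show ?case by simp
  next
    case (2 J) then show ?case
      by (auto simp: compositions_def PiE_def extensional_def)
  next
    case (3 b) then show ?case
      by (auto simp: compositions_def PiE_def extensional_def)
  next
    case (4 b) then show ?case
      by (auto simp: compositions_def PiE_def extensional_def)
  next
    case (5 J) then show ?case by simp
  qed
  also have "\<dots> = (\<Sum>i\<le>j. a (Suc p) ^ i / fact i * ((\<Sum>l=0..p. a l) ^ (j - i) / fact (j - i)))"
    by (simp only: Suc sum_distrib_left) (simp add: sum.Sigma finite_compositions)
  also have "\<dots> = (\<Sum>i\<le>j. real (j choose i) * a (Suc p) ^ i * (\<Sum>l=0..p. a l) ^ (j - i)) / fact j"
    unfolding sum_divide_distrib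
    by (intro sum.cong refl) (simp add: binomial_fact)
  also have "\<dots> = (\<Sum>l=0..Suc p. a l) ^ j / fact j"
    by (subst binomial_ring[symmetric]) (simp add: add.commute)
  finally show ?case by simp
qed

section \<open>Evaluation of the iterated integral\<close>

text \<open>The integrand of the theorem with an arbitrary function \<open>g\<close> in place of
  \<open>Li k\<close>, so that both sides of the expansion of \<open>Li k\<close> can be
  inserted.\<close>

definition iterated_integrand ::
    "(real \<Rightarrow> real) \<Rightarrow> nat \<Rightarrow> (nat \<Rightarrow> nat) \<Rightarrow> real \<Rightarrow> (nat \<Rightarrow> real) \<Rightarrow> real" where
  "iterated_integrand g p n x t =
     ln ((1 - x) / (1 - t p)) ^ n p / t p *
     (\<Prod>l\<in>{1..<p}. ln ((1 - t (l + 1)) / (1 - t l)) ^ n l / t l) * g (t 1)"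

lemma ordered_region_bounds:
  assumes t: "t \<in> ordered_region p x" and l: "l \<in> {1..p}"
  shows "x < t l" "t l < 1"
proof -
  have mono: "t j \<le> t i" if "1 \<le> i" "i \<le> j" "j \<le> p" for i j
    using that(2,1,3)
  proof (induction j rule: dec_induct)
    case (step j)
    then have "t (Suc j) < t j" using t by (auto simp: ordered_region_def)
    then show ?case using step by auto
  qed simp
  show "x < t l" "t l < 1"
    using mono[of l p] mono[of 1 l] l t by (auto simp: ordered_region_def)
qed

text \<open>On the region the coordinates decrease along the index and stay in
  \<open>(x, 1)\<close>, so every quotient under a logarithm is at least 1.\<close>

lemma iterated_integrand_nonneg:
  assumes t: "t \<in> ordered_region p x" and p: "1 \<le> p" and x: "0 < x"
    and g: "\<And>u. 0 < u \<Longrightarrow> u < 1 \<Longrightarrow> 0 \<le> g u"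
  shows "0 \<le> iterated_integrand g p n x t"
proof -
  have b: "x < t l" "t l < 1" if "l \<in> {1..p}" for l
    using ordered_region_bounds[OF t that] by auto
  have l: "0 \<le> ln ((1 - t (l + 1)) / (1 - t l)) ^ n l / t l" if "l \<in> {1..<p}" for l
  proof -
    have "t (l + 1) < t l" using t that by (auto simp: ordered_region_def)
    then show ?thesis
      using that b[of l] b[of "l + 1"] x
      by (intro divide_nonneg_nonneg zero_le_power) (auto simp: le_divide_eq)
  qed
  have l: "0 \<le> (\<Prod>l\<in>{1..<p}. ln ((1 - t (l + 1)) / (1 - t l)) ^ n l / t l)"
    using l by (rule prod_nonneg)
  show ?thesis
    unfolding iterated_integrand_def
    using b[of p] b[of 1] p x
    by (intro mult_nonneg_nonneg divide_nonneg_nonneg zero_le_power l g)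
       (auto simp: le_divide_eq)
qed

lemma iterated_integrand_measurable:
  assumes p: "1 \<le> p" and [measurable]: "g \<in> borel_measurable borel"
  shows "(\<lambda>t. indicator (ordered_region p x) t * iterated_integrand g p n x t)
           \<in> borel_measurable (\<Pi>\<^sub>M l\<in>{1..p}. lborel)"
proof -
  have c: "(\<lambda>t. t l :: real) \<in> borel_measurable (\<Pi>\<^sub>M l\<in>{1..p}. lborel)" if "l \<in> {1..p}" for l :: nat
    using measurable_component_singleton[OF that, of "\<lambda>_. lborel :: real measure"] by simp
  have [measurable]: "(\<lambda>t. t p :: real) \<in> borel_measurable (\<Pi>\<^sub>M l\<in>{1..p}. lborel)"
    "(\<lambda>t. t 1 :: real) \<in> borel_measurable (\<Pi>\<^sub>M l\<in>{1..p}. lborel)"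
    "(\<lambda>t. t (Suc 0) :: real) \<in> borel_measurable (\<Pi>\<^sub>M l\<in>{1..p}. lborel)"
    using p by (auto intro!: c)
  have [measurable]: "(\<lambda>t :: nat \<Rightarrow> real. \<Prod>l\<in>{1..<p}. ln ((1 - t (l + 1)) / (1 - t l)) ^ n l / t l)
      \<in> borel_measurable (\<Pi>\<^sub>M l\<in>{1..p}. lborel)"
  proof (rule borel_measurable_prod)
    fix l assume "l \<in> {1..<p}"
    then have [measurable]: "(\<lambda>t. t (l + 1) :: real) \<in> borel_measurable (\<Pi>\<^sub>M l\<in>{1..p}. lborel)"
      "(\<lambda>t. t l :: real) \<in> borel_measurable (\<Pi>\<^sub>M l\<in>{1..p}. lborel)"
      using c[of l] c[of "l + 1"] by auto
    show "(\<lambda>t :: nat \<Rightarrow> real. ln ((1 - t (l + 1)) / (1 - t l)) ^ n l / t l)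
        \<in> borel_measurable (\<Pi>\<^sub>M l\<in>{1..p}. lborel)"
      by measurable
  qed
  have [measurable]: "Measurable.pred (\<Pi>\<^sub>M l\<in>{1..p}. lborel) (\<lambda>t. \<forall>l\<in>{1..<p}. t (Suc l) < (t l :: real))"
  proof (rule pred_intros_finite)
    fix l assume "l \<in> {1..<p}"
    then have [measurable]: "(\<lambda>t. t (Suc l) :: real) \<in> borel_measurable (\<Pi>\<^sub>M l\<in>{1..p}. lborel)"
      "(\<lambda>t. t l :: real) \<in> borel_measurable (\<Pi>\<^sub>M l\<in>{1..p}. lborel)"
      using c[of l] c[of "l + 1"] by auto
    show "Measurable.pred (\<Pi>\<^sub>M l\<in>{1..p}. lborel) (\<lambda>t. t (Suc l) < (t l :: real))"
      by measurable
  qed simp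
  show ?thesis
    unfolding iterated_integrand_def indicator_def ordered_region_def mem_Collect_eq
    by measurable
qed

text \<open>The new coordinate \<open>y\<close> is the smallest and serves as lower bound for the
  others. Its bound \<open>y < 1\<close> is implied by theirs, but stating it makes the outer
  integral one over an interval.\<close>

lemma ordered_region_Suc:
  assumes p: "1 \<le> p"
  shows "t(Suc p := y) \<in> ordered_region (Suc p) x \<longleftrightarrow> y \<in> {x<..<1} \<and> t \<in> ordered_region p y"
proof -
  have "{1..<Suc p} = insert p {1..<p}" using p by auto
  then have "t(Suc p := y) \<in> ordered_region (Suc p) x \<longleftrightarrow> x < y \<and> t \<in> ordered_region p y"
    using p by (auto simp: ordered_region_def)
  moreover have "y < 1" if "t \<in> ordered_region p y"
    using ordered_region_bounds[OF that, of 1] p by auto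
  ultimately show ?thesis by auto
qed

text \<open>The factor coupling \<open>t p\<close> to its lower neighbour \<open>y\<close> is the
  leading factor of the shorter integrand with lower bound \<open>y\<close>.\<close>

lemma iterated_integrand_Suc:
  assumes p: "1 \<le> p"
  shows "iterated_integrand g (Suc p) n x (t(Suc p := y)) =
    ln ((1 - x) / (1 - y)) ^ n (Suc p) / y * iterated_integrand g p n y t"
proof -
  have "(\<Prod>l\<in>{1..<Suc p}. ln ((1 - (t(Suc p := y)) (l + 1)) / (1 - (t(Suc p := y)) l)) ^ n l / (t(Suc p := y)) l)
    = (\<Prod>l\<in>{1..<p}. ln ((1 - t (l + 1)) / (1 - t l)) ^ n l / t l)
       * (ln ((1 - y) / (1 - t p)) ^ n p / t p)"
    using p by (subst prod.atLeastLessThan_Suc) auto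
  then show ?thesis
    using p unfolding iterated_integrand_def by (simp add: mult_ac)
qed

text \<open>Induction on \<open>p\<close> for all lower bounds: by Tonelli the smallest variable is
  integrated last, and that integration prepends the entry \<open>n (Suc p) + 1\<close>. Hence the
  entries appear in reversed order.\<close>

lemma nn_integral_iterated_integrand:
  assumes "1 \<le> p" "0 < x" "x < 1"
  shows "(\<integral>\<^sup>+t. ennreal (indicator (ordered_region p x) t *
             iterated_integrand (\<lambda>u. polylog k (1 - u)) p n x t) \<partial>(\<Pi>\<^sub>M l\<in>{1..p}. lborel))
     = ennreal ((\<Prod>l=1..p. fact (n l)) *
         polylog (map (\<lambda>l. n l + 1) (rev [1..<Suc p]) @ k) (1 - x))"
  using assms
proof (induction p arbitrary: x rule: dec_induct)
  case base
  interpret product_sigma_finite "\<lambda>_. lborel :: real measure"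
    by standard
  have "(\<integral>\<^sup>+t. ennreal (indicator (ordered_region 1 x) t *
             iterated_integrand (\<lambda>u. polylog k (1 - u)) 1 n x t) \<partial>(\<Pi>\<^sub>M l\<in>{1..1}. lborel))
      = (\<integral>\<^sup>+t. ennreal (indicator {x<..<1} (t 1) *
             (ln ((1 - x) / (1 - t 1)) ^ n 1 / t 1 * polylog k (1 - t 1))) \<partial>(\<Pi>\<^sub>M l\<in>{1::nat}. lborel))"
    by (auto intro!: nn_integral_cong simp: ordered_region_def iterated_integrand_def indicator_def)
  also have "\<dots> = ennreal (fact (n 1) * polylog (Suc (n 1) # k) (1 - x))"
    using nn_integral_polylog_Cons_reflected[OF base.prems, of "n 1" k]
    by (subst product_nn_integral_singleton) simp_all
  finally show ?case by simp
next
  case (step p)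
  interpret product_sigma_finite "\<lambda>_. lborel :: real measure"
    by standard
  define G where "G = iterated_integrand (\<lambda>u. polylog k (1 - u))"
  define w where "w = map (\<lambda>l. n l + 1) (rev [1..<Suc p]) @ k"
  define C where "C = (\<Prod>l=1..p. fact (n l) :: real)"
  have C: "0 \<le> C" by (simp add: C_def prod_nonneg)
  have ins: "{1..Suc p} = insert (Suc p) {1..p}" by auto
  have [measurable]: "(\<lambda>t. indicator (ordered_region p y) t * G p n y t)
           \<in> borel_measurable (\<Pi>\<^sub>M l\<in>{1..p}. lborel)" for y
    unfolding G_def using step.hyps by (intro iterated_integrand_measurable) auto
  have meas: "(\<lambda>t. indicator (ordered_region (Suc p) x) t * G (Suc p) n x t)
           \<in> borel_measurable (\<Pi>\<^sub>M l\<in>{1..Suc p}. lborel)"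
    unfolding G_def by (intro iterated_integrand_measurable) auto
  have "(\<integral>\<^sup>+t. ennreal (indicator (ordered_region (Suc p) x) t * G (Suc p) n x t) \<partial>(\<Pi>\<^sub>M l\<in>{1..Suc p}. lborel))
     = (\<integral>\<^sup>+y. \<integral>\<^sup>+t. ennreal (indicator (ordered_region (Suc p) x) (t(Suc p := y)) *
           G (Suc p) n x (t(Suc p := y))) \<partial>(\<Pi>\<^sub>M l\<in>{1..p}. lborel) \<partial>lborel)"
    unfolding ins using meas[unfolded ins]
    by (intro product_nn_integral_insert_rev) auto
  also have "\<dots> = (\<integral>\<^sup>+y. \<integral>\<^sup>+t. ennreal (indicator {x<..<1} y * (ln ((1 - x) / (1 - y)) ^ n (Suc p) / y)) *
       ennreal (indicator (ordered_region p y) t * G p n y t) \<partial>(\<Pi>\<^sub>M l\<in>{1..p}. lborel) \<partial>lborel)"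
  \<comment> \<open>The factor depending on \<open>y\<close> alone is non-negative, so
    \<open>ennreal\<close> splits the product and the factor can leave the inner integral.\<close>
  proof (intro nn_integral_cong)
    fix y t
    have "0 \<le> indicator {x<..<1} y * (ln ((1 - x) / (1 - y)) ^ n (Suc p) / y)"
      using step.prems by (auto simp: indicator_def le_divide_eq intro!: divide_nonneg_nonneg zero_le_power)
    then show "ennreal (indicator (ordered_region (Suc p) x) (t(Suc p := y)) * G (Suc p) n x (t(Suc p := y)))
      = ennreal (indicator {x<..<1} y * (ln ((1 - x) / (1 - y)) ^ n (Suc p) / y)) *
       ennreal (indicator (ordered_region p y) t * G p n y t)"
      using step.hyps
      by (subst ennreal_mult'[symmetric])
         (auto simp: G_def iterated_integrand_Suc ordered_region_Suc indicator_def simp del: fun_upd_apply)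
  qed
  also have "\<dots> = (\<integral>\<^sup>+y. ennreal (indicator {x<..<1} y * (ln ((1 - x) / (1 - y)) ^ n (Suc p) / y)) *
       (\<integral>\<^sup>+t. ennreal (indicator (ordered_region p y) t * G p n y t) \<partial>(\<Pi>\<^sub>M l\<in>{1..p}. lborel)) \<partial>lborel)"
    by (intro nn_integral_cong nn_integral_cmult) measurable
  also have "\<dots> = (\<integral>\<^sup>+y. ennreal C * ennreal (indicator {x<..<1} y *
       (ln ((1 - x) / (1 - y)) ^ n (Suc p) / y * polylog w (1 - y))) \<partial>lborel)"
  proof (intro nn_integral_cong)
    fix y :: real
    show "ennreal (indicator {x<..<1} y * (ln ((1 - x) / (1 - y)) ^ n (Suc p) / y)) *
       (\<integral>\<^sup>+t. ennreal (indicator (ordered_region p y) t * G p n y t) \<partial>(\<Pi>\<^sub>M l\<in>{1..p}. lborel))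
      = ennreal C * ennreal (indicator {x<..<1} y *
       (ln ((1 - x) / (1 - y)) ^ n (Suc p) / y * polylog w (1 - y)))"
    \<comment> \<open>Inside the interval the induction hypothesis applies with lower bound
      \<open>y\<close>; outside it both sides vanish.\<close>
    proof (cases "y \<in> {x<..<1}")
      case True
      then have y: "0 < y" "y < 1" "x < y" using step.prems by auto
      have "0 \<le> ln ((1 - x) / (1 - y)) ^ n (Suc p) / y"
        using y by (auto simp: le_divide_eq intro!: divide_nonneg_nonneg zero_le_power)
      then show ?thesis
        unfolding step.IH[OF y(1,2), folded G_def C_def w_def]
        using True C y polylog_nonneg[of "1 - y" w]
        by (simp add: ennreal_mult'[symmetric] mult_ac)
    qed simp
  qed
  also have "\<dots> = ennreal C * ennreal (fact (n (Suc p)) * polylog (Suc (n (Suc p)) # w) (1 - x))"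
    by (subst nn_integral_cmult, measurable)
       (simp only: nn_integral_polylog_Cons_reflected[OF step.prems])
  also have "\<dots> = ennreal ((\<Prod>l=1..Suc p. fact (n l)) *
         polylog (map (\<lambda>l. n l + 1) (rev [1..<Suc (Suc p)]) @ k) (1 - x))"
    using C step.hyps by (simp add: ennreal_mult'[symmetric] C_def w_def mult_ac)
  finally show ?case unfolding G_def .
qed

text \<open>A non-negative integrand with finite integral is integrable; this passes to the Bochner
  integral, where combinations with coefficients of either sign are available.\<close>

lemma integral_iterated_integrand:
  fixes k :: "nat list" and n :: "nat \<Rightarrow> nat"
  assumes p: "1 \<le> p" and x: "0 < x" "x < 1"
  defines "f \<equiv> (\<lambda>t. indicator (ordered_region p x) t * iterated_integrand (\<lambda>u. polylog k (1 - u)) p n x t)"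
  shows "integrable (\<Pi>\<^sub>M l\<in>{1..p}. lborel) f"
    and "(LINT t|(\<Pi>\<^sub>M l\<in>{1..p}. lborel). f t) =
      (\<Prod>l=1..p. fact (n l)) * polylog (map (\<lambda>l. n l + 1) (rev [1..<Suc p]) @ k) (1 - x)"
proof -
  have m: "f \<in> borel_measurable (\<Pi>\<^sub>M l\<in>{1..p}. lborel)"
    unfolding f_def using p by (intro iterated_integrand_measurable) auto
  have nn: "0 \<le> f t" for t
    unfolding f_def using p x
    by (cases "t \<in> ordered_region p x") (auto intro!: iterated_integrand_nonneg polylog_nonneg)
  have "0 \<le> (\<Prod>l=1..p. fact (n l)) * polylog (map (\<lambda>l. n l + 1) (rev [1..<Suc p]) @ k) (1 - x)"
    using x by (intro mult_nonneg_nonneg prod_nonneg polylog_nonneg) auto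
  from nn_integral_eq_integrable[OF m _ this] nn_integral_iterated_integrand[OF p x, of k n] nn
  show "integrable (\<Pi>\<^sub>M l\<in>{1..p}. lborel) f"
    and "(LINT t|(\<Pi>\<^sub>M l\<in>{1..p}. lborel). f t) =
      (\<Prod>l=1..p. fact (n l)) * polylog (map (\<lambda>l. n l + 1) (rev [1..<Suc p]) @ k) (1 - x)"
    unfolding f_def by auto
qed

section \<open>Absorbing the logarithm of the innermost variable\<close>

lemma sum_log_ratios:
  fixes t :: "nat \<Rightarrow> real"
  assumes p: "1 \<le> p" and x: "x < 1" and t: "\<And>l. l \<in> {1..p} \<Longrightarrow> t l < 1"
  shows "ln ((1 - x) / (1 - t p)) + (\<Sum>l\<in>{1..<p}. ln ((1 - t (l + 1)) / (1 - t l)))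
    = ln (1 - x) - ln (1 - t 1)"
proof -
  have "(\<Sum>l\<in>{1..<p}. ln ((1 - t (l + 1)) / (1 - t l))) = (\<Sum>l\<in>{1..<p}. ln (1 - t (Suc l)) - ln (1 - t l))"
  proof (intro sum.cong refl)
    fix l assume "l \<in> {1..<p}"
    then have "t l < 1" "t (l + 1) < 1" using t[of l] t[of "l + 1"] by auto
    then show "ln ((1 - t (l + 1)) / (1 - t l)) = ln (1 - t (Suc l)) - ln (1 - t l)"
      by (simp add: ln_div)
  qed
  also have "\<dots> = ln (1 - t p) - ln (1 - t 1)"
    using p by (rule sum_Suc_diff')
  finally show ?thesis using t[of p] x p by (simp add: ln_div)
qed

text \<open>By telescoping, \<open>- ln (1 - t 1)\<close> is \<open>- ln (1 - x)\<close> plus the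
  \<open>p\<close> logarithms already in the integrand; each multinomial term then raises their
  exponents from \<open>m l\<close> to \<open>m l + J l\<close>.\<close>

lemma iterated_integrand_log_power:
  assumes t: "t \<in> ordered_region p x" and p: "1 \<le> p" and x: "0 < x" "x < 1"
  shows "iterated_integrand (\<lambda>u. (- ln (1 - u)) ^ j / fact j * g u) p m x t =
     (\<Sum>J\<in>compositions p j. (- ln (1 - x)) ^ J 0 / fact (J 0) * (\<Prod>l=1..p. 1 / fact (J l)) *
        iterated_integrand g p (\<lambda>l. m l + J l) x t)"
proof -
  \<comment> \<open>The \<open>p + 1\<close> summands of the telescoped logarithm. Below,
    \<open>b\<close> has the same values for \<open>1 \<le> l \<le> p\<close> and writes the
    integrand as one product, without singling out \<open>l = p\<close>.\<close>
  define a where "a l = (if l = 0 then - ln (1 - x) else if l = p then ln ((1 - x) / (1 - t p))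
    else ln ((1 - t (l + 1)) / (1 - t l)))" for l
  define b where "b l = (if l = p then ln ((1 - x) / (1 - t p)) else ln ((1 - t (l + 1)) / (1 - t l)))" for l
  have split: "{1..p} = insert p {1..<p}" using p by auto
  have I: "iterated_integrand h p n x t = (\<Prod>l=1..p. b l ^ n l / t l) * h (t 1)" for h n
    unfolding iterated_integrand_def split by (simp add: b_def)
  have ab: "(\<Prod>l=1..p. a l ^ J l) = (\<Prod>l=1..p. b l ^ J l)" for J
    by (intro prod.cong) (auto simp: a_def b_def)
  have "(\<Sum>l=0..p. a l) = - ln (1 - x) + (\<Sum>l\<in>{1..p}. b l)"
    using p by (subst sum.atLeast_Suc_atMost) (auto simp: a_def b_def intro!: sum.cong)
  also have "\<dots> = - ln (1 - t 1)"
    using sum_log_ratios[OF p x(2), of t] ordered_region_bounds[OF t]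
    unfolding split by (simp add: b_def)
  finally have "(- ln (1 - t 1)) ^ j / fact j = (\<Sum>J\<in>compositions p j. \<Prod>l=0..p. a l ^ J l / fact (J l))"
    by (simp add: multinomial_compositions[symmetric])
  also have "\<dots> = (\<Sum>J\<in>compositions p j. (- ln (1 - x)) ^ J 0 / fact (J 0) *
      ((\<Prod>l=1..p. 1 / fact (J l)) * (\<Prod>l=1..p. b l ^ J l)))"
    using p
    by (intro sum.cong refl, subst prod.atLeast_Suc_atMost)
       (auto simp: a_def b_def prod.distrib[symmetric] intro!: prod.cong)
  finally show ?thesis
    unfolding I sum_distrib_right sum_distrib_left
    by (simp add: sum_distrib_left sum_distrib_right prod.distrib prod_dividef power_add mult_ac)
qed

section \<open>Integration of the Kaneko-Tsumura expansion and comparison of constants\<close>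

theorem theorem2p4:
  fixes p :: nat and m :: "nat \<Rightarrow> nat" and k :: "nat list" and x :: real
    and c :: "nat list \<Rightarrow> nat list \<Rightarrow> nat \<Rightarrow> real"
  assumes "kaneko_tsumura_coeffs c"
    and "1 \<le> p"
    and "is_index k" and "k \<noteq> []"
    and "0 < x" and "x < 1"
  shows "set_integrable (\<Pi>\<^sub>M l\<in>{1..p}. lborel) (ordered_region p x) (integrand p m k x) \<and>
    (LINT t:ordered_region p x|(\<Pi>\<^sub>M l\<in>{1..p}. lborel). integrand p m k x t) =
      (\<Prod>l=1..p. fact (m l)) *
      (\<Sum>(k', j)\<in>bounded_pairs (weight k). c k k' j *
         (\<Sum>J\<in>compositions p j.
            (- 1) ^ J 0 / fact (J 0) *
            (\<Prod>l=1..p. real ((m l + J l) choose J l)) *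
            ln (1 - x) ^ J 0 *
            Li (map (\<lambda>l. m l + J l + 1) (rev [1..<Suc p]) @ k') (1 - x)))"
proof -
  note p = \<open>1 \<le> p\<close> and x = \<open>0 < x\<close> \<open>x < 1\<close>
  define M where "M = (\<Pi>\<^sub>M l\<in>{1..p}. lborel :: real measure)"
  define P where "P = bounded_pairs (weight k)"
  \<comment> \<open>The constant of the composition \<open>J\<close> in the multinomial expansion;
    \<open>e\<close> below is its counterpart in the claimed formula.\<close>
  define d where "d J = (- ln (1 - x)) ^ J 0 / fact (J 0) * (\<Prod>l=1..p. 1 / fact (J l))" for J :: "nat \<Rightarrow> nat"
  define f where "f k' J t = indicator (ordered_region p x) t *
      iterated_integrand (\<lambda>u. polylog k' (1 - u)) p (\<lambda>l. m l + J l) x t" for k' J t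
  define L where "L J k' = polylog (map (\<lambda>l. m l + J l + 1) (rev [1..<Suc p]) @ k') (1 - x)" for J k'
  \<comment> \<open>The expansion is taken at \<open>y = 1 - u\<close>, where \<open>Li\<close> of
    \<open>j\<close> ones becomes a power of the logarithm.\<close>
  have KT: "Li k u = (\<Sum>(k', j)\<in>P. c k k' j * ((- ln (1 - u)) ^ j / fact j * polylog k' (1 - u)))"
    if u: "0 < u" "u < 1" for u
  proof -
    have "\<forall>y. 0 < y \<and> y < 1 \<longrightarrow>
        Li k (1 - y) = (\<Sum>(k', j)\<in>P. c k k' j * Li (replicate j 1) (1 - y) * Li k' y)"
      using assms(1,3) unfolding kaneko_tsumura_coeffs_def P_def by blast
    from this[rule_format, of "1 - u"] show ?thesis
      using u by (simp add: Li_eq_polylog polylog_replicate_1 mult.assoc del: One_nat_def)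
  qed
  \<comment> \<open>The indicators make this an identity for every \<open>t\<close>, both sides
    being 0 off the region, so it can be integrated as it stands.\<close>
  have integrand_eq: "indicator (ordered_region p x) t * integrand p m k x t =
      (\<Sum>(k', j)\<in>P. c k k' j * (\<Sum>J\<in>compositions p j. d J * f k' J t))" for t
  proof (cases "t \<in> ordered_region p x")
    case True
    then have t1: "0 < t 1" "t 1 < 1"
      using ordered_region_bounds[OF True, of 1] p x by auto
    define w where "w = iterated_integrand (\<lambda>_. 1) p m x t"
    have W: "iterated_integrand g p m x t = w * g (t 1)" for g
      by (simp add: w_def iterated_integrand_def)
    have integrand: "integrand p m k x t = w * Li k (t 1)"
      by (simp add: w_def iterated_integrand_def integrand_def)
    have "integrand p m k x t = (\<Sum>(k', j)\<in>P. c k k' j *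
       iterated_integrand (\<lambda>u. (- ln (1 - u)) ^ j / fact j * polylog k' (1 - u)) p m x t)"
      unfolding integrand W KT[OF t1]
      by (simp add: sum_distrib_left case_prod_unfold mult_ac)
    also have "\<dots> = (\<Sum>(k', j)\<in>P. c k k' j * (\<Sum>J\<in>compositions p j. d J * f k' J t))"
      unfolding iterated_integrand_log_power[OF True p x] using True by (simp add: d_def f_def)
    finally show ?thesis using True by simp
  qed (simp add: f_def)
  have f: "integrable M (f k' J)"
    "(LINT t|M. f k' J t) = (\<Prod>l=1..p. fact (m l + J l)) * L J k'" for k' J
    unfolding f_def[abs_def] M_def L_def using integral_iterated_integrand[OF p x] by auto
  define K where "K = (\<Prod>l=1..p. fact (m l) :: real)"
  define e where "e J = (- 1) ^ J 0 / fact (J 0) * (\<Prod>l=1..p. real ((m l + J l) choose J l)) * ln (1 - x) ^ J 0"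
    for J
  have coeff: "d J * ((\<Prod>l=1..p. fact (m l + J l)) * L J k') = K * (e J * L J k')" for J k'
  proof -
    \<comment> \<open>The two inputs will be \<open>(m + J)! / J! = m! * binomial (m + J) J\<close>,
      multiplied over all positions, and the sign \<open>(-1) ^ J 0\<close> extracted from the power
      of \<open>- ln (1 - x)\<close>.\<close>
    have arith: "s / f0 * q * (r * b) = K * (a / f0 * h * v * b)"
      if "q * r = K * h" "s = a * v" for s f0 q r b a h v :: real
    proof -
      have "s / f0 * q * (r * b) = s / f0 * (q * r) * b" by (simp add: mult_ac)
      then show ?thesis unfolding that by (simp add: mult_ac)
    qed
    have "(\<Prod>l=1..p. 1 / fact (J l)) * (\<Prod>l=1..p. fact (m l + J l)) =
        K * (\<Prod>l=1..p. real ((m l + J l) choose J l))"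
      unfolding prod.distrib[symmetric] K_def
      by (intro prod.cong refl) (simp add: binomial_fact)
    then show ?thesis
      unfolding d_def e_def by (rule arith) (rule power_minus)
  qed
  have LiL: "Li (map (\<lambda>l. m l + J l + 1) (rev [1..<Suc p]) @ k') (1 - x) = L J k'" for J k'
    unfolding L_def using x by (intro Li_eq_polylog) auto
  \<comment> \<open>The integrand is a finite linear combination of the integrable functions
    \<open>f k' J\<close>, whatever the signs of the coefficients.\<close>
  have integrable: "integrable M (\<lambda>t. indicator (ordered_region p x) t * integrand p m k x t)"
    unfolding integrand_eq case_prod_unfold
    by (intro Bochner_Integration.integrable_sum integrable_mult_right f)
  have "(LINT t|M. indicator (ordered_region p x) t * integrand p m k x t) =
      (\<Sum>(k', j)\<in>P. c k k' j * (\<Sum>J\<in>compositions p j. d J * ((\<Prod>l=1..p. fact (m l + J l)) * L J k')))"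
    unfolding integrand_eq case_prod_unfold
    by (simp only: Bochner_Integration.integral_sum Bochner_Integration.integrable_sum
        integrable_mult_right integral_mult_right_zero f simp_thms)
  also have "\<dots> = K * (\<Sum>(k', j)\<in>P. c k k' j * (\<Sum>J\<in>compositions p j. e J * L J k'))"
    unfolding coeff by (simp add: sum_distrib_left case_prod_unfold mult_ac)
  finally show ?thesis
    using integrable
    unfolding set_integrable_def set_lebesgue_integral_def LiL real_scaleR_def
    by (simp only: M_def P_def K_def e_def)
qed

end
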